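(* Let $b\in\mathbb{R}^N$. Then $b\in\mathcal{C}_A$ if and only if $$0\le b^Tp\quad\forall\,p\in Q_{A,0}^\diamond\qquad\text{and}\qquad b_i\le b^Tp\quad\forall\,p\in Q_{A,a_i}^*,\ \forall\,i\in\{1,\ldots,N\},$$ and this pair of conditions is equivalent to $$0\le b^Tp\quad\forall\,p\in\mathrm{ext}(Q_{A,0}^\diamond)\qquad\text{and}\qquad b_i\le b^Tp\quad\forall\,p\in\mathrm{ext}(Q_{A,a_i}^* ),\ \forall\,i\in\{1,\ldots,N\}.$$
   Context: Let $A\in\mathbb{R}^{N\times d}$ be a fixed matrix whose rows $a_1^T,\ldots,a_N^T$ are pairwise distinct and satisfy $\|a_i\|_2=1$ for $i=1,\ldots,N$. Let $\mathbb{R}_+:=\{s\in\mathbb{R}:s\ge0\}$ and let $\mathbf{1}=(1,\ldots,1)^T\in\mathbb{R}^N$. For $b\in\mathbb{R}^N$ and $c\in\mathbb{R}^d$ put $$Q_{A,b}:=\{x\in\mathbb{R}^d:Ax\le b\},\quad Q_{A,c}^*:=\{p\in\mathbb{R}^N_+:A^Tp=c\},\quad Q_{A,0}^\diamond:=\{q\in\mathbb{R}^N_+:A^Tq=0,\ \mathbf{1}^Tq=1\},$$ $$\mathcal{C}_A:=\{b\in\mathbb{R}^N:\ \forall\, i\in\{1,\ldots,N\}\ \exists\, x_i\in Q_{A,b}\ \text{with}\ a_i^Tx_i=b_i\}.$$ For a closed convex set $C$, $\mathrm{ext}(C)$ denotes its set of extreme points. The set $\mathrm{ext}(Q_{A,0}^\diamond)$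 may be empty. *)

theory Defs
  imports "HOL-Analysis.Analysis"
begin

text \<open>
  The order on \<^typ>\<open>real ^ 'n\<close> is componentwise, and \<^term>\<open>1 :: real ^ 'n\<close> is the vector
  with all entries equal to one.
\<close>

definition Q_poly :: "real ^ 'd ^ 'n \<Rightarrow> real ^ 'n \<Rightarrow> (real ^ 'd) set" where
  "Q_poly A b = {x. A *v x \<le> b}"

definition Q_star :: "real ^ 'd ^ 'n \<Rightarrow> real ^ 'd \<Rightarrow> (real ^ 'n) set" where
  "Q_star A c = {p. 0 \<le> p \<and> transpose A *v p = c}"

definition Q_diamond :: "real ^ 'd ^ 'n \<Rightarrow> (real ^ 'n) set" where
  "Q_diamond A = {q. 0 \<le> q \<and> transpose A *v q = 0 \<and> 1 \<bullet> q = 1}"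

definition C_set :: "real ^ 'd ^ 'n \<Rightarrow> (real ^ 'n) set" where
  "C_set A = {b. \<forall>i. \<exists>x \<in> Q_poly A b. row i A \<bullet> x = b $ i}"

definition ext :: "'a::real_vector set \<Rightarrow> 'a set" where
  "ext S = {x. x extreme_point_of S}"

end

theory Submission
  imports Defs
begin

text \<open>
  Two ideas carry the proof: linear programming duality and the decomposition of a pointed
  polyhedron into its vertices and its recession directions.

  For fixed \<open>i\<close>, a point \<open>x \<in> Q_poly A b\<close> with \<open>row i A \<bullet> x = b $ i\<close> is a solution of the
  inequality system \<open>A *v x \<le> b\<close>, \<open>- row i A \<bullet> x \<le> - b $ i\<close>.  By Farkas' lemma
  (\<open>farkas_family\<close>) this system is either solvable or refuted by a multiplier \<open>p \<ge> 0\<close> for the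
  rows of \<open>A\<close> together with a multiplier \<open>t \<ge> 0\<close> for the reversed inequality.  If \<open>t > 0\<close>, then
  \<open>p / t\<close> lies in \<open>Q_star A (row i A)\<close> and violates \<open>b $ i \<le> b \<bullet> p\<close>.  If \<open>t = 0\<close>, then \<open>p\<close> is a
  nonzero nonnegative element of the kernel of \<open>transpose A\<close>, and rescaling it to entry sum one
  gives a violation on \<open>Q_diamond A\<close>.  The converse implication is weak duality.

  For the reduction to extreme points, \<open>Q_diamond A\<close> is compact and convex, so it is the convex
  hull of its extreme points.  The set \<open>Q_star A c\<close> may be unbounded, but its recession cone is
  generated by \<open>Q_diamond A\<close>, on which \<open>b\<close> is already known to be nonnegative.  From a
  point \<open>p\<close> of \<open>Q_star A c\<close> that is not extreme, one can therefore move inside the smallest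
  face containing \<open>p\<close>, without increasing \<open>b \<bullet> p\<close>, until a further coordinate vanishes; induction on the size of the support ends at an extreme point.
\<close>

section \<open>Farkas' lemma for a finite family of inequalities\<close>

lemma convex_cone_hull_range:
  fixes v :: "'k::finite \<Rightarrow> 'a::real_vector"
  assumes "z \<in> convex_cone hull (range v)"
  obtains p where "\<And>k. 0 \<le> p k" "z = (\<Sum>k\<in>UNIV. p k *\<^sub>R v k)"
proof -
  define K where "K = {z. \<exists>p. (\<forall>k. 0 \<le> p k) \<and> z = (\<Sum>k\<in>UNIV. p k *\<^sub>R v k)}"
  have "range v \<subseteq> K"
  proof clarify
    fix k
    have "(\<Sum>j\<in>UNIV. (if j = k then 1 else 0) *\<^sub>R v j) = (\<Sum>j\<in>UNIV. if j = k then v j else 0)"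
      by (rule sum.cong) auto
    then show "v k \<in> K"
      by (auto simp: K_def intro!: exI[of _ "\<lambda>j. if j = k then 1 else 0"])
  qed
  moreover have "convex_cone K"
    unfolding convex_cone_iff
  proof (intro conjI ballI allI impI)
    show "0 \<in> K"
      by (auto simp: K_def intro!: exI[of _ "\<lambda>_. 0"])
  next
    fix x y assume "x \<in> K" "y \<in> K"
    then obtain p q where "\<forall>k. 0 \<le> p k" "x = (\<Sum>k\<in>UNIV. p k *\<^sub>R v k)"
      "\<forall>k. 0 \<le> q k" "y = (\<Sum>k\<in>UNIV. q k *\<^sub>R v k)"
      by (auto simp: K_def)
    then show "x + y \<in> K"
      by (auto simp: K_def scaleR_add_left sum.distrib intro!: exI[of _ "\<lambda>k. p k + q k"])
  next
    fix x and c :: real assume "x \<in> K" "0 \<le> c"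
    then obtain p where "\<forall>k. 0 \<le> p k" "x = (\<Sum>k\<in>UNIV. p k *\<^sub>R v k)"
      by (auto simp: K_def)
    with \<open>0 \<le> c\<close> show "c *\<^sub>R x \<in> K"
      by (auto simp: K_def scaleR_sum_right intro!: exI[of _ "\<lambda>k. c * p k"])
  qed
  ultimately have "convex_cone hull (range v) \<subseteq> K"
    by (rule hull_minimal)
  with assms that show thesis
    by (auto simp: K_def)
qed

text \<open>
  A finitely generated cone is closed, so a point outside it can be strictly separated from it;
  homogeneity of the cone moves the separating hyperplane to the origin.
\<close>

lemma finitely_generated_cone_separation:
  fixes S :: "'a::euclidean_space set"
  assumes "finite S" "z \<notin> convex_cone hull S"
  obtains y where "\<And>v. v \<in> S \<Longrightarrow> 0 \<le> y \<bullet> v" "y \<bullet> z < 0"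
proof -
  obtain y \<beta> where y: "y \<bullet> z < \<beta>" "\<And>v. v \<in> convex_cone hull S \<Longrightarrow> \<beta> < y \<bullet> v"
    using separating_hyperplane_closed_point[OF convex_convex_cone_hull
        closed_convex_cone_hull[OF assms(1)] assms(2)] by blast
  have "\<beta> < 0"
    using y(2)[OF convex_cone_hull_contains_0] by simp
  have "0 \<le> y \<bullet> v" if "v \<in> S" for v
  proof (rule ccontr)
    assume neg: "\<not> 0 \<le> y \<bullet> v"
    \<comment> \<open>A generator on the negative side could be scaled until it reaches the hyperplane.\<close>
    have "(\<beta> / (y \<bullet> v)) *\<^sub>R v \<in> convex_cone hull S"
      using that neg \<open>\<beta> < 0\<close> by (intro convex_cone_hull_mul hull_inc) (auto simp: divide_nonpos_neg)
    from y(2)[OF this] neg show False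
      by simp
  qed
  moreover have "y \<bullet> z < 0"
    using y(1) \<open>\<beta> < 0\<close> by simp
  ultimately show thesis
    using that by blast
qed

text \<open>
  The system is homogenised: it is solvable exactly when \<open>(0, -1)\<close> lies outside the cone
  generated by the pairs \<open>(a k, \<beta> k)\<close>.  Membership of \<open>(0, -1)\<close> provides the multipliers of a
  contradiction, and a separating functional \<open>(x, s)\<close> has \<open>s > 0\<close> and provides
  the solution \<open>- x / s\<close>.
\<close>

lemma farkas_family:
  fixes a :: "'k::finite \<Rightarrow> 'a::euclidean_space" and \<beta> :: "'k \<Rightarrow> real"
  assumes infeasible: "\<nexists>x. \<forall>k. a k \<bullet> x \<le> \<beta> k"
  obtains p where "\<And>k. 0 \<le> p k" "(\<Sum>k\<in>UNIV. p k *\<^sub>R a k) = 0" "(\<Sum>k\<in>UNIV. p k * \<beta> k) < 0"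
proof -
  have "(0, -1) \<in> convex_cone hull (range (\<lambda>k. (a k, \<beta> k)))"
  proof (rule ccontr)
    assume outside: "\<not> ?thesis"
    have "finite (range (\<lambda>k. (a k, \<beta> k)))"
      by simp
    from finitely_generated_cone_separation[OF this outside] obtain y where y: "\<And>v. v \<in> range (\<lambda>k. (a k, \<beta> k)) \<Longrightarrow> 0 \<le> y \<bullet> v"
      "y \<bullet> (0, -1) < 0"
      by blast
    obtain x s where xs: "y = (x, s)"
      by (cases y)
    have "s > 0"
      using y(2) by (simp add: xs)
    have "a k \<bullet> ((- 1 / s) *\<^sub>R x) \<le> \<beta> k" for k
    proof -
      have "0 \<le> x \<bullet> a k + s * \<beta> k"
        using y(1)[of "(a k, \<beta> k)"] by (simp add: xs)
      with \<open>s > 0\<close> show ?thesis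
        by (simp add: field_simps inner_commute)
    qed
    with infeasible show False
      by blast
  qed
  then obtain p where p: "\<And>k. 0 \<le> p k" "(0, -1) = (\<Sum>k\<in>UNIV. p k *\<^sub>R (a k, \<beta> k))"
    by (rule convex_cone_hull_range) blast
  have "(\<Sum>k\<in>UNIV. p k *\<^sub>R a k) = 0"
    using arg_cong[OF p(2), of fst] by (simp add: fst_sum)
  moreover have "(\<Sum>k\<in>UNIV. p k * \<beta> k) = - 1"
    using arg_cong[OF p(2), of snd] by (simp add: snd_sum)
  ultimately show thesis
    using that[of p] p(1) by simp
qed

section \<open>Duality for tight inequalities\<close>

lemma transpose_mult_eq_row_sum:
  fixes A :: "real ^ 'd ^ 'n"
  shows "transpose A *v p = (\<Sum>j\<in>UNIV. p $ j *\<^sub>R row j A)"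
  by (simp add: vec_eq_iff row_def vector_matrix_mult_def mult.commute)

lemma inner_matrix_vector_mult:
  fixes A :: "real ^ 'd ^ 'n"
  shows "(A *v x) \<bullet> p = x \<bullet> (transpose A *v p)"
  by (metis dot_lmul_matrix inner_commute transpose_matrix_vector)

lemma inner_mono_nonneg:
  fixes p :: "real ^ 'n"
  assumes "u \<le> v" "0 \<le> p"
  shows "u \<bullet> p \<le> v \<bullet> p"
  using assms by (auto simp: inner_vec_def less_eq_vec_def intro!: sum_mono mult_right_mono)

lemma dual_conditions_if_mem_C_set:
  assumes "b \<in> C_set A"
  shows "(\<forall>p \<in> Q_diamond A. 0 \<le> b \<bullet> p) \<and> (\<forall>i. \<forall>p \<in> Q_star A (row i A). b $ i \<le> b \<bullet> p)"
proof -
  have weak: "x \<bullet> (transpose A *v p) \<le> b \<bullet> p" if "x \<in> Q_poly A b" "0 \<le> p" for x p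
    using inner_mono_nonneg[of "A *v x" b p] that by (simp add: Q_poly_def inner_matrix_vector_mult
        del: transpose_matrix_vector)
  have tight: "\<exists>x \<in> Q_poly A b. row i A \<bullet> x = b $ i" for i
    using assms by (simp add: C_set_def)
  show ?thesis
  proof (intro conjI ballI allI)
    fix p assume p: "p \<in> Q_diamond A"
    obtain x where "x \<in> Q_poly A b"
      using tight by blast
    from weak[OF this, of p] p show "0 \<le> b \<bullet> p"
      by (simp add: Q_diamond_def del: transpose_matrix_vector)
  next
    fix i p assume p: "p \<in> Q_star A (row i A)"
    obtain x where "x \<in> Q_poly A b" "row i A \<bullet> x = b $ i"
      using tight by blast
    with weak[OF this(1), of p] p show "b $ i \<le> b \<bullet> p"
      by (simp add: Q_star_def inner_commute del: transpose_matrix_vector)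
  qed
qed

text \<open>
  Every nonzero element of the recession cone of \<open>Q_star A c\<close> is a positive multiple of an element
  of \<open>Q_diamond A\<close>.
\<close>

lemma inner_nonneg_on_recession_cone:
  fixes A :: "real ^ 'd ^ 'n"
  assumes diamond: "\<forall>p \<in> Q_diamond A. 0 \<le> b \<bullet> p"
    and q: "0 \<le> q" "transpose A *v q = 0"
  shows "0 \<le> b \<bullet> q"
proof (cases "q = 0")
  case False
  have "1 \<bullet> q = (\<Sum>j\<in>UNIV. q $ j)"
    by (simp add: inner_vec_def)
  moreover have "(\<Sum>j\<in>UNIV. q $ j) \<noteq> 0"
    using False q(1) by (auto simp: sum_nonneg_eq_0_iff vec_eq_iff less_eq_vec_def)
  moreover have "(\<Sum>j\<in>UNIV. q $ j) \<ge> 0"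
    using q(1) by (auto simp: less_eq_vec_def intro: sum_nonneg)
  ultimately have pos: "1 \<bullet> q > 0"
    by simp
  then have "(1 / (1 \<bullet> q)) *\<^sub>R q \<in> Q_diamond A"
    using q by (simp add: Q_diamond_def less_eq_vec_def matrix_vector_mult_scaleR
        del: transpose_matrix_vector)
  with diamond have "0 \<le> b \<bullet> ((1 / (1 \<bullet> q)) *\<^sub>R q)"
    by blast
  with pos show ?thesis
    by (simp add: zero_le_divide_iff)
qed simp

lemma mem_C_set_if_dual_conditions:
  fixes A :: "real ^ 'd ^ 'n"
  assumes diamond: "\<forall>p \<in> Q_diamond A. 0 \<le> b \<bullet> p"
    and star: "\<forall>i. \<forall>p \<in> Q_star A (row i A). b $ i \<le> b \<bullet> p"
  shows "b \<in> C_set A"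
  unfolding C_set_def
proof (intro CollectI allI)
  fix i
  \<comment> \<open>The index \<open>None\<close> carries the reversed inequality \<open>b $ i \<le> row i A \<bullet> x\<close>.\<close>
  define a where "a k = (case k of None \<Rightarrow> - row i A | Some j \<Rightarrow> row j A)" for k
  define \<beta> where "\<beta> k = (case k of None \<Rightarrow> - b $ i | Some j \<Rightarrow> b $ j)" for k
  have "\<exists>x. \<forall>k. a k \<bullet> x \<le> \<beta> k"
  proof (rule ccontr)
    assume "\<nexists>x. \<forall>k. a k \<bullet> x \<le> \<beta> k"
    then obtain p where p: "\<And>k. 0 \<le> p k" "(\<Sum>k\<in>UNIV. p k *\<^sub>R a k) = 0"
      "(\<Sum>k\<in>UNIV. p k * \<beta> k) < 0"
      by (rule farkas_family) blast
    define q where "q = (\<chi> j. p (Some j))"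
    define t where "t = p None"
    have q: "0 \<le> q" and t: "0 \<le> t"
      using p(1) by (simp_all add: q_def t_def less_eq_vec_def)
    have Aq: "transpose A *v q = t *\<^sub>R row i A"
      using p(2) by (simp add: UNIV_option_conv sum.reindex a_def q_def t_def
          transpose_mult_eq_row_sum del: transpose_matrix_vector)
    have bq: "b \<bullet> q < t * b $ i"
      using p(3) by (simp add: UNIV_option_conv sum.reindex \<beta>_def q_def t_def inner_vec_def
          mult.commute)
    show False
    proof (cases "t = 0")
      case True
      with inner_nonneg_on_recession_cone[OF diamond q] Aq bq show False
        by simp
    next
      case False
      with t have "t > 0"
        by simp
      with q Aq have "(1 / t) *\<^sub>R q \<in> Q_star A (row i A)"
        by (simp add: Q_star_def less_eq_vec_def matrix_vector_mult_scaleR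
            del: transpose_matrix_vector)
      with star have "b $ i \<le> b \<bullet> ((1 / t) *\<^sub>R q)"
        by blast
      with bq \<open>t > 0\<close> show False
        by (simp add: field_simps)
    qed
  qed
  then obtain x where x: "\<And>k. a k \<bullet> x \<le> \<beta> k"
    by blast
  have "row j A \<bullet> x \<le> b $ j" for j
    using x[of "Some j"] by (simp add: a_def \<beta>_def)
  moreover have "b $ i \<le> row i A \<bullet> x"
    using x[of None] by (simp add: a_def \<beta>_def)
  moreover have "(A *v x) $ j = row j A \<bullet> x" for j
    by (simp add: matrix_vector_mul_component row_def)
  ultimately have "x \<in> Q_poly A b" "row i A \<bullet> x = b $ i"
    by (auto simp: Q_poly_def less_eq_vec_def intro: antisym)
  then show "\<exists>x\<in>Q_poly A b. row i A \<bullet> x = b $ i"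
    by blast
qed

section \<open>Reduction to extreme points\<close>

lemma compact_Q_diamond: "compact (Q_diamond A)"
proof -
  have "p \<in> cbox 0 1" if "p \<in> Q_diamond A" for p
  proof -
    have p: "\<And>j. 0 \<le> p $ j" "(\<Sum>j\<in>UNIV. p $ j) = 1"
      using that by (auto simp: Q_diamond_def less_eq_vec_def inner_vec_def)
    have "p $ j \<le> 1" for j
      using member_le_sum[of j UNIV "\<lambda>j. p $ j"] p by simp
    with p(1) show ?thesis
      by (simp add: mem_box_cart)
  qed
  then have "bounded (Q_diamond A)"
    by (meson bounded_cbox bounded_subset subsetI)
  moreover have "closed (Q_diamond A)"
    unfolding Q_diamond_def less_eq_vec_def
    by (intro closed_Collect_conj closed_Collect_all closed_Collect_le closed_Collect_eq
        continuous_intros matrix_vector_mult_linear_continuous_on)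
  ultimately show ?thesis
    by (simp add: compact_eq_bounded_closed)
qed

lemma convex_Q_diamond: "convex (Q_diamond A)"
  unfolding convex_def Q_diamond_def
  by (auto simp: less_eq_vec_def matrix_vector_right_distrib matrix_vector_mult_scaleR inner_right_distrib
      simp del: transpose_matrix_vector)

lemma Q_diamond_nonneg_if_ext_nonneg:
  assumes "\<forall>p \<in> ext (Q_diamond A). 0 \<le> b \<bullet> p"
  shows "\<forall>p \<in> Q_diamond A. 0 \<le> b \<bullet> p"
proof -
  have "convex hull (ext (Q_diamond A)) \<subseteq> {p. 0 \<le> b \<bullet> p}"
    using assms convex_halfspace_ge[of 0 b] by (intro hull_minimal) auto
  moreover have "Q_diamond A = convex hull (ext (Q_diamond A))"
    unfolding ext_def by (rule Krein_Milman_Minkowski[OF compact_Q_diamond convex_Q_diamond])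
  ultimately show ?thesis
    by blast
qed

text \<open>
  The step length is the largest one that keeps the point in the orthant; at that length a
  coordinate attaining the minimal ratio becomes zero.
\<close>

lemma ray_exit_shrinks_support:
  fixes p d :: "real ^ 'n"
  assumes p: "0 \<le> p" and supp: "\<And>j. p $ j = 0 \<Longrightarrow> d $ j = 0" and neg: "d $ k < 0"
  obtains t where "0 \<le> t" "0 \<le> p + t *\<^sub>R d" "{j. (p + t *\<^sub>R d) $ j \<noteq> 0} \<subset> {j. p $ j \<noteq> 0}"
proof -
  define N where "N = {j. d $ j < 0}"
  define t where "t = Min ((\<lambda>j. p $ j / - d $ j) ` N)"
  have "finite N" "N \<noteq> {}"
    using neg by (auto simp: N_def)
  then have "t \<in> (\<lambda>j. p $ j / - d $ j) ` N"
    unfolding t_def by (intro Min_in) auto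
  then obtain m where m: "d $ m < 0" "t = p $ m / - d $ m"
    by (auto simp: N_def)
  have le: "t \<le> p $ j / - d $ j" if "d $ j < 0" for j
    using that \<open>finite N\<close> by (auto simp: t_def N_def)
  have p_nonneg: "0 \<le> p $ j" for j
    using p by (simp add: less_eq_vec_def)
  have "0 \<le> t"
    using m p_nonneg[of m] by (simp add: divide_nonneg_neg)
  have "0 \<le> p $ j + t * d $ j" for j
  proof (cases "d $ j < 0")
    case True
    with le[OF True] show ?thesis
      by (simp add: field_simps)
  next
    case False
    with \<open>0 \<le> t\<close> p_nonneg[of j] show ?thesis
      by simp
  qed
  then have "0 \<le> p + t *\<^sub>R d"
    by (simp add: less_eq_vec_def)
  moreover have "{j. (p + t *\<^sub>R d) $ j \<noteq> 0} \<subset> {j. p $ j \<noteq> 0}"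
  proof
    show "{j. (p + t *\<^sub>R d) $ j \<noteq> 0} \<subseteq> {j. p $ j \<noteq> 0}"
      using supp by auto
    have "p $ m \<noteq> 0" "(p + t *\<^sub>R d) $ m = 0"
      using m supp[of m] by auto
    then show "{j. (p + t *\<^sub>R d) $ j \<noteq> 0} \<noteq> {j. p $ j \<noteq> 0}"
      by blast
  qed
  ultimately show thesis
    using that \<open>0 \<le> t\<close> by blast
qed

text \<open>
  Through a point that is not extreme there is a line on which the zero coordinates stay zero and
  the constraint \<open>transpose A *v p = c\<close> is preserved.  Of its two directions, choose
  one that does not increase the objective; the condition on \<open>Q_diamond A\<close> allows choosing it
  with a negative entry, because a nonnegative direction is a recession direction, on which the
  objective can only be constant, and may then be reversed.
\<close>

lemma Q_star_descent_direction:
  fixes A :: "real ^ 'd ^ 'n"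
  assumes diamond: "\<forall>p \<in> Q_diamond A. 0 \<le> b \<bullet> p"
    and p: "p \<in> Q_star A c" "p \<notin> ext (Q_star A c)"
  obtains d k where "transpose A *v d = 0" "\<And>j. p $ j = 0 \<Longrightarrow> d $ j = 0" "b \<bullet> d \<le> 0" "d $ k < 0"
proof -
  obtain x y where xy: "x \<in> Q_star A c" "y \<in> Q_star A c" "p \<in> open_segment x y"
    using p by (auto simp: ext_def extreme_point_of_def)
  then obtain u where u: "x \<noteq> y" "0 < u" "u < 1" "p = (1 - u) *\<^sub>R x + u *\<^sub>R y"
    by (auto simp: in_segment)
  have x: "\<And>j. 0 \<le> x $ j" "transpose A *v x = c" and y: "\<And>j. 0 \<le> y $ j" "transpose A *v y = c"
    using xy by (auto simp: Q_star_def less_eq_vec_def)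
  have zero: "x $ j = 0 \<and> y $ j = 0" if "p $ j = 0" for j
  proof -
    have "(1 - u) * x $ j + u * y $ j = 0"
      using that u(4) by simp
    moreover have "0 \<le> (1 - u) * x $ j" "0 \<le> u * y $ j"
      using x(1) y(1) u by simp_all
    ultimately have "(1 - u) * x $ j = 0" "u * y $ j = 0"
      by linarith+
    with u show ?thesis
      by simp
  qed
  have "\<exists>d. d \<noteq> 0 \<and> transpose A *v d = 0 \<and> (\<forall>j. p $ j = 0 \<longrightarrow> d $ j = 0) \<and> b \<bullet> d \<le> 0"
  proof (cases "b \<bullet> (y - x) \<le> 0")
    case True
    with u(1) x y zero show ?thesis
      by (intro exI[of _ "y - x"])
        (simp add: matrix_vector_mult_diff_distrib del: transpose_matrix_vector)
  next
    case False
    with u(1) x y zero show ?thesis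
      by (intro exI[of _ "x - y"])
        (simp add: matrix_vector_mult_diff_distrib inner_diff_right del: transpose_matrix_vector)
  qed
  then obtain d where d: "d \<noteq> 0" "transpose A *v d = 0" "\<And>j. p $ j = 0 \<Longrightarrow> d $ j = 0" "b \<bullet> d \<le> 0"
    by blast
  show thesis
  proof (cases "0 \<le> d")
    case True
    with inner_nonneg_on_recession_cone[OF diamond] d have "b \<bullet> d = 0"
      by (simp add: order_antisym)
    moreover from \<open>d \<noteq> 0\<close> obtain k where "d $ k \<noteq> 0"
      by (auto simp: vec_eq_iff)
    moreover have "0 \<le> d $ k"
      using True by (simp add: less_eq_vec_def)
    moreover have "transpose A *v (- d) = 0"
      using d(2) matrix_vector_mult_diff_distrib[of "transpose A" 0 d]
      by (simp del: transpose_matrix_vector)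
    ultimately show thesis
      using that[of "- d" k] d(3) by simp
  next
    case False
    then show thesis
      using that d by (auto simp: less_eq_vec_def not_le)
  qed
qed

lemma Q_star_bound_if_ext_bound:
  fixes A :: "real ^ 'd ^ 'n"
  assumes diamond: "\<forall>p \<in> Q_diamond A. 0 \<le> b \<bullet> p"
    and bound: "\<forall>p \<in> ext (Q_star A c). \<gamma> \<le> b \<bullet> p"
  shows "\<forall>p \<in> Q_star A c. \<gamma> \<le> b \<bullet> p"
proof
  fix p assume "p \<in> Q_star A c"
  then show "\<gamma> \<le> b \<bullet> p"
  proof (induction "card {j. p $ j \<noteq> 0}" arbitrary: p rule: less_induct)
    case less
    show ?case
    proof (cases "p \<in> ext (Q_star A c)")
      case False
      then obtain d k where d: "transpose A *v d = 0" "\<And>j. p $ j = 0 \<Longrightarrow> d $ j = 0" "b \<bullet> d \<le> 0"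
        "d $ k < 0"
        using Q_star_descent_direction[OF diamond less.prems] by blast
      have p: "0 \<le> p" "transpose A *v p = c"
        using less.prems by (simp_all add: Q_star_def)
      obtain t where t: "0 \<le> t" "0 \<le> p + t *\<^sub>R d"
        "{j. (p + t *\<^sub>R d) $ j \<noteq> 0} \<subset> {j. p $ j \<noteq> 0}"
        using ray_exit_shrinks_support[OF p(1) d(2,4)] by blast
      have "p + t *\<^sub>R d \<in> Q_star A c"
        using p t d by (simp add: Q_star_def matrix_vector_right_distrib matrix_vector_mult_scaleR
            del: transpose_matrix_vector)
      with less.hyps t(3) have "\<gamma> \<le> b \<bullet> (p + t *\<^sub>R d)"
        by (simp add: psubset_card_mono del: vector_add_component vector_scaleR_component)
      also have "\<dots> \<le> b \<bullet> p"
        using t(1) d(3) by (simp add: inner_right_distrib mult_nonneg_nonpos)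
      finally show ?thesis .
    qed (use bound in blast)
  qed
qed

lemma ext_subset: "ext S \<subseteq> S"
  by (auto simp: ext_def extreme_point_of_def)

theorem theorem16:
  fixes A :: "real ^ 'd ^ 'n" and b :: "real ^ 'n"
  assumes rows_distinct: "\<forall>i j. i \<noteq> j \<longrightarrow> row i A \<noteq> row j A"
    and rows_unit: "\<forall>i. norm (row i A) = 1"
  shows "(b \<in> C_set A \<longleftrightarrow>
           (\<forall>p \<in> Q_diamond A. 0 \<le> b \<bullet> p) \<and>
           (\<forall>i. \<forall>p \<in> Q_star A (row i A). b $ i \<le> b \<bullet> p)) \<and>
         ((\<forall>p \<in> Q_diamond A. 0 \<le> b \<bullet> p) \<and>
          (\<forall>i. \<forall>p \<in> Q_star A (row i A). b $ i \<le> b \<bullet> p) \<longleftrightarrow>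
          (\<forall>p \<in> ext (Q_diamond A). 0 \<le> b \<bullet> p) \<and>
          (\<forall>i. \<forall>p \<in> ext (Q_star A (row i A)). b $ i \<le> b \<bullet> p))"
proof (intro conjI)
  show "b \<in> C_set A \<longleftrightarrow>
      (\<forall>p \<in> Q_diamond A. 0 \<le> b \<bullet> p) \<and> (\<forall>i. \<forall>p \<in> Q_star A (row i A). b $ i \<le> b \<bullet> p)"
    using dual_conditions_if_mem_C_set mem_C_set_if_dual_conditions by blast
  show "(\<forall>p \<in> Q_diamond A. 0 \<le> b \<bullet> p) \<and>
      (\<forall>i. \<forall>p \<in> Q_star A (row i A). b $ i \<le> b \<bullet> p) \<longleftrightarrow>
      (\<forall>p \<in> ext (Q_diamond A). 0 \<le> b \<bullet> p) \<and>
      (\<forall>i. \<forall>p \<in> ext (Q_star A (row i A)). b $ i \<le> b \<bullet> p)" (is "?all \<longleftrightarrow> ?extreme")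
  proof
    assume ?all
    then show ?extreme
      using ext_subset by blast
  next
    assume extreme: ?extreme
    then have diamond: "\<forall>p \<in> Q_diamond A. 0 \<le> b \<bullet> p"
      using Q_diamond_nonneg_if_ext_nonneg by blast
    with extreme show ?all
      using Q_star_bound_if_ext_bound[OF diamond] by blast
  qed
qed

end
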